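(* Let $X$ be a Banach space with $\dim X\ge 2$, let $0\le\alpha\le\frac12$ and $1\le p<\infty$. Then $$\frac{1}{2^{p-1}}\bigl(\rho_X(1-2\alpha)+1\bigr)^p\le C^I_{NJ}(\alpha,p,X)\le\widetilde{C}^{(p)}_{NJ}(X).$$
   Context: $S_X$ denotes the unit sphere of $X$. For $x_1,x_2\in X$, isosceles orthogonality $x_1\perp_I x_2$ means $\|x_1+x_2\|=\|x_1-x_2\|$. For $1\le p<\infty$ and $0\le\alpha\le\frac12$, $$C^{I}_{NJ}(\alpha,p,X)=\sup\left\{\frac{\|\alpha x_1+(1-\alpha)x_2\|^{p}+\|(1-\alpha)x_1+\alpha x_2\|^{p}}{\|x_1+x_2\|^{p}}: x_1,x_2\in X,\ (x_1,x_2)\neq(0,0),\ x_1\perp_I x_2\right\}.$$ The modulus of smoothness is, for $t\ge0$, $$\rho_X(t)=\sup\left\{\frac{\|x_1+tx_2\|+\|x_1-tx_2\|}{2}-1: x_1,x_2\in S_X\right\}.$$ The modified $p$-th von Neumann–Jordan constant is $$\widetilde{C}^{(p)}_{NJ}(X)=\sup\left\{\frac{\|x_1+x_2\|^p+\|x_1-x_2\|^p}{2^p}: x_1,x_2\in S_X\right\}.$$ *)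

theory Defs
  imports "HOL-Analysis.Analysis"
begin

(* The space X is the whole type 'a, passed as a type argument. Since p >= 1 in all uses,
   powr is the ordinary real power on norms (including 0 powr p = 0). The suprema are taken in
   the reals; the lemmas below show that the sets are bounded above. They are nonempty
   as soon as the unit sphere is. *)

definition isosceles_orth :: "'a::real_normed_vector \<Rightarrow> 'a \<Rightarrow> bool"  (infix "\<bottom>\<^sub>I" 50)
  where "x \<bottom>\<^sub>I y \<longleftrightarrow> norm (x + y) = norm (x - y)"

definition C_NJ_I :: "real \<Rightarrow> real \<Rightarrow> 'a::real_normed_vector itself \<Rightarrow> real"
  where "C_NJ_I \<alpha> p X =
    Sup {(norm (\<alpha> *\<^sub>R x1 + (1 - \<alpha>) *\<^sub>R x2) powr p + norm ((1 - \<alpha>) *\<^sub>R x1 + \<alpha> *\<^sub>R x2) powr p)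
           / norm (x1 + x2) powr p
         | x1 x2 :: 'a. (x1, x2) \<noteq> (0, 0) \<and> x1 \<bottom>\<^sub>I x2}"

definition mod_smoothness :: "'a::real_normed_vector itself \<Rightarrow> real \<Rightarrow> real"
  where "mod_smoothness X t =
    Sup {(norm (x1 + t *\<^sub>R x2) + norm (x1 - t *\<^sub>R x2)) / 2 - 1
         | x1 x2 :: 'a. x1 \<in> sphere 0 1 \<and> x2 \<in> sphere 0 1}"

definition C_NJ_mod :: "real \<Rightarrow> 'a::real_normed_vector itself \<Rightarrow> real"
  where "C_NJ_mod p X =
    Sup {(norm (x1 + x2) powr p + norm (x1 - x2) powr p) / 2 powr p
         | x1 x2 :: 'a. x1 \<in> sphere 0 1 \<and> x2 \<in> sphere 0 1}"

lemma bdd_above_C_NJ_I: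
  assumes "0 \<le> \<alpha>" "\<alpha> \<le> 1 / 2" "1 \<le> p"
  shows "bdd_above {(norm (\<alpha> *\<^sub>R x1 + (1 - \<alpha>) *\<^sub>R x2) powr p
                       + norm ((1 - \<alpha>) *\<^sub>R x1 + \<alpha> *\<^sub>R x2) powr p) / norm (x1 + x2) powr p
         | x1 x2 :: 'a::real_normed_vector. (x1, x2) \<noteq> (0, 0) \<and> x1 \<bottom>\<^sub>I x2}"
proof (rule bdd_aboveI[where M = 2], elim CollectE exE conjE)
  fix r and x y :: 'a
  assume r: "r = (norm (\<alpha> *\<^sub>R x + (1 - \<alpha>) *\<^sub>R y) powr p
                   + norm ((1 - \<alpha>) *\<^sub>R x + \<alpha> *\<^sub>R y) powr p) / norm (x + y) powr p"
    and o: "x \<bottom>\<^sub>I y"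
  let ?s = "norm (x + y)"
  have eq: "norm (x - y) = ?s" using o by (simp add: isosceles_orth_def)
  have le: "norm ((1/2) *\<^sub>R (x + y) + c *\<^sub>R (x - y)) \<le> ?s" if "\<bar>c\<bar> \<le> 1 / 2" for c
  proof -
    have "norm ((1/2) *\<^sub>R (x + y) + c *\<^sub>R (x - y)) \<le> (1/2) * ?s + \<bar>c\<bar> * ?s"
      by (rule order_trans[OF norm_triangle_ineq]) (simp add: eq)
    also have "\<dots> \<le> (1/2) * ?s + (1/2) * ?s"
      using that by (intro add_left_mono mult_right_mono) auto
    finally show ?thesis by simp
  qed
  have h: "z = (1/2) *\<^sub>R z + (1/2) *\<^sub>R z" for z :: 'a
    by (simp flip: scaleR_add_left)
  have "\<alpha> *\<^sub>R x + (1 - \<alpha>) *\<^sub>R y = (1/2) *\<^sub>R (x + y) + (\<alpha> - 1/2) *\<^sub>R (x - y)"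
    using h[of y] by (simp add: algebra_simps)
  then have 1: "norm (\<alpha> *\<^sub>R x + (1 - \<alpha>) *\<^sub>R y) powr p \<le> ?s powr p"
    using le[of "\<alpha> - 1/2"] assms by (intro powr_mono2) auto
  have "(1 - \<alpha>) *\<^sub>R x + \<alpha> *\<^sub>R y = (1/2) *\<^sub>R (x + y) + (1/2 - \<alpha>) *\<^sub>R (x - y)"
    using h[of x] by (simp add: algebra_simps)
  then have 2: "norm ((1 - \<alpha>) *\<^sub>R x + \<alpha> *\<^sub>R y) powr p \<le> ?s powr p"
    using le[of "1/2 - \<alpha>"] assms by (intro powr_mono2) auto
  show "r \<le> 2"
  proof (cases "?s powr p = 0")
    case True
    show ?thesis unfolding r True by simp
  next
    case False
    then have "0 < ?s powr p" by (simp add: less_le)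
    then show ?thesis using 1 2 unfolding r pos_divide_le_eq[OF \<open>0 < ?s powr p\<close>] by linarith
  qed
qed

lemma bdd_above_mod_smoothness:
  "bdd_above {(norm (x1 + t *\<^sub>R x2) + norm (x1 - t *\<^sub>R x2)) / 2 - 1
         | x1 x2 :: 'a::real_normed_vector. x1 \<in> sphere 0 1 \<and> x2 \<in> sphere 0 1}"
proof (rule bdd_aboveI[where M = "\<bar>t\<bar>"], clarify)
  fix x y :: 'a
  assume "x \<in> sphere 0 1" "y \<in> sphere 0 1"
  then show "(norm (x + t *\<^sub>R y) + norm (x - t *\<^sub>R y)) / 2 - 1 \<le> \<bar>t\<bar>"
    using norm_triangle_ineq[of x "t *\<^sub>R y"] norm_triangle_ineq4[of x "t *\<^sub>R y"]
    by (simp add: field_simps)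
qed

lemma bdd_above_C_NJ_mod:
  assumes "1 \<le> p"
  shows "bdd_above {(norm (x1 + x2) powr p + norm (x1 - x2) powr p) / 2 powr p
         | x1 x2 :: 'a::real_normed_vector. x1 \<in> sphere 0 1 \<and> x2 \<in> sphere 0 1}"
proof (rule bdd_aboveI[where M = 2], clarify)
  fix x y :: 'a
  assume "x \<in> sphere 0 1" "y \<in> sphere 0 1"
  then have "norm (x + y) powr p \<le> 2 powr p" "norm (x - y) powr p \<le> 2 powr p"
    using norm_triangle_ineq[of x y] norm_triangle_ineq4[of x y] assms
    by (auto intro!: powr_mono2)
  then show "(norm (x + y) powr p + norm (x - y) powr p) / 2 powr p \<le> 2"
    by (simp add: divide_simps)
qed

end

theory Submission
  imports Defs
begin

text \<open>Put \<open>u = x1 + x2\<close> and \<open>v = x1 - x2\<close>. Isosceles orthogonality says that \<open>u\<close> and \<open>v\<close> have the same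
  norm, which may be normalised to \<open>1\<close>, so that with \<open>t = 1 - 2 * \<alpha>\<close> the constant is the supremum
  of \<open>(norm (u + t v) powr p + norm (u - t v) powr p) / 2 powr p\<close> over unit vectors \<open>u\<close>, \<open>v\<close>. Both
  bounds are instances of convexity of \<open>s powr p\<close>: the lower one averages the two norms; for the
  upper one, \<open>u + t v\<close> and \<open>u - t v\<close> are complementary convex combinations of \<open>u + v\<close> and \<open>u - v\<close>.\<close>

text \<open>For positive \<open>x\<close> and \<open>y\<close> this is convexity of
  \<open>s powr p\<close> on the open half-line. If one of them is 0, its term vanishes and the
  claim reduces to \<open>c powr p \<le> c\<close> for a weight \<open>c\<close> in [0, 1].\<close>

lemma powr_convex_combination_le:
  fixes x y p m :: real
  assumes "1 \<le> p" "0 \<le> x" "0 \<le> y" "0 \<le> m" "m \<le> 1"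
  shows "(m * x + (1 - m) * y) powr p \<le> m * x powr p + (1 - m) * y powr p"
proof -
  have scale: "(c * z) powr p \<le> c * z powr p" if "0 \<le> c" "c \<le> 1" "0 \<le> z" for c z :: real
  proof -
    have "c powr p \<le> c"
      using powr_mono'[of 1 p c] that assms(1) by simp
    then show ?thesis
      using that by (simp add: powr_mult mult_right_mono)
  qed
  show ?thesis
  proof (cases "x = 0 \<or> y = 0")
    case True
    then show ?thesis
      using scale[of m x] scale[of "1 - m" y] assms by auto
  next
    case False
    then have "x \<in> {0<..}" "y \<in> {0<..}" using assms by auto
    then show ?thesis
      using convex_onD[OF powr_convex[OF assms(1)], of "1 - m" x y] assms by simp
  qed
qed

text \<open>Convexity with weight 1/2, rescaled so that the right side has the denominator
  \<open>2 powr p\<close> of the spherical quotients.\<close>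

lemma powr_mean_le:
  fixes x y p :: real
  assumes "1 \<le> p" "0 \<le> x" "0 \<le> y"
  shows "1 / 2 powr (p - 1) * ((x + y) / 2) powr p \<le> (x powr p + y powr p) / 2 powr p"
proof -
  have "((x + y) / 2) powr p \<le> (x powr p + y powr p) / 2"
    using powr_convex_combination_le[of p x y "1/2"] assms by (simp add: field_simps)
  moreover have "2 powr p = 2 * 2 powr (p - 1)"
    by (simp add: powr_diff)
  ultimately show ?thesis
    by (simp add: field_simps)
qed

lemma norm_powr_add_diff_mono:
  fixes u v :: "'a::real_normed_vector"
  assumes "1 \<le> p" "0 \<le> t" "t \<le> 1"
  shows "norm (u + t *\<^sub>R v) powr p + norm (u - t *\<^sub>R v) powr p
           \<le> norm (u + v) powr p + norm (u - v) powr p"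
proof -
  \<comment> \<open>Chosen so that \<open>m - (1 - m) = t\<close>, the coefficient of
    \<open>v\<close> in the combination of \<open>u + v\<close> and \<open>u - v\<close> with
    weights \<open>m\<close> and \<open>1 - m\<close>.\<close>
  define m where "m = (1 + t) / 2"
  have m: "0 \<le> m" "m \<le> 1" "t = 2 * m - 1"
    using assms by (auto simp: m_def field_simps)
  have "u + t *\<^sub>R v = m *\<^sub>R (u + v) + (1 - m) *\<^sub>R (u - v)"
    and "u - t *\<^sub>R v = m *\<^sub>R (u - v) + (1 - m) *\<^sub>R (u + v)"
    by (simp_all add: m(3) algebra_simps flip: scaleR_2)
  then have "norm (u + t *\<^sub>R v) \<le> m * norm (u + v) + (1 - m) * norm (u - v)"
    and "norm (u - t *\<^sub>R v) \<le> m * norm (u - v) + (1 - m) * norm (u + v)"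
    using m norm_triangle_ineq[of "m *\<^sub>R (u + v)" "(1 - m) *\<^sub>R (u - v)"]
      norm_triangle_ineq[of "m *\<^sub>R (u - v)" "(1 - m) *\<^sub>R (u + v)"] by auto
  then have "norm (u + t *\<^sub>R v) powr p \<le> m * norm (u + v) powr p + (1 - m) * norm (u - v) powr p"
    and "norm (u - t *\<^sub>R v) powr p \<le> m * norm (u - v) powr p + (1 - m) * norm (u + v) powr p"
    using m assms by (auto intro!: order_trans[OF powr_mono2 powr_convex_combination_le])
  \<comment> \<open>On adding the two estimates, each power gets total weight
    \<open>m + (1 - m) = 1\<close>.\<close>
  then show ?thesis by (simp add: algebra_simps)
qed

text \<open>Already the sets of quotients are equal, so their suprema agree. Orthogonal pairs other
  than (0, 0) are the pairs \<open>(s / 2) *\<^sub>R (u + v)\<close>,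
  \<open>(s / 2) *\<^sub>R (u - v)\<close> with \<open>s > 0\<close> and unit vectors
  \<open>u\<close>, \<open>v\<close>.\<close>

lemma C_NJ_I_eq_Sup_sphere:
  "C_NJ_I \<alpha> p TYPE('a::real_normed_vector) =
     Sup {(norm (u + (1 - 2 * \<alpha>) *\<^sub>R v) powr p + norm (u - (1 - 2 * \<alpha>) *\<^sub>R v) powr p) / 2 powr p
          | u v :: 'a. u \<in> sphere 0 1 \<and> v \<in> sphere 0 1}"
proof -
  define t where "t = 1 - 2 * \<alpha>"
  define F where "F x y = (norm (\<alpha> *\<^sub>R x + (1 - \<alpha>) *\<^sub>R y) powr p
      + norm ((1 - \<alpha>) *\<^sub>R x + \<alpha> *\<^sub>R y) powr p) / norm (x + y) powr p" for x y :: 'a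
  define G where "G u v = (norm (u + t *\<^sub>R v) powr p + norm (u - t *\<^sub>R v) powr p) / 2 powr p"
    for u v :: 'a
  \<comment> \<open>The numerator has the factor \<open>(s / 2) powr p\<close> and, as
    \<open>norm u = 1\<close>, the denominator is \<open>s powr p\<close>; the scale cancels and
    \<open>2 powr p\<close> remains below.\<close>
  have F_eq_G: "F ((s / 2) *\<^sub>R (u + v)) ((s / 2) *\<^sub>R (u - v)) = G u v"
    if "0 < s" "norm u = 1" for s and u v :: 'a
  proof -
    have collect: "a *\<^sub>R (s / 2) *\<^sub>R (u + v) + b *\<^sub>R (s / 2) *\<^sub>R (u - v)
        = (s / 2) *\<^sub>R ((a + b) *\<^sub>R u + (a - b) *\<^sub>R v)" for a b
      by (simp add: algebra_simps)
    have "(2 * \<alpha> - 1) *\<^sub>R v = - (t *\<^sub>R v)" "1 - \<alpha> - \<alpha> = t"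
      by (simp_all add: t_def algebra_simps)
    then have "\<alpha> *\<^sub>R (s / 2) *\<^sub>R (u + v) + (1 - \<alpha>) *\<^sub>R (s / 2) *\<^sub>R (u - v) = (s / 2) *\<^sub>R (u - t *\<^sub>R v)"
      and "(1 - \<alpha>) *\<^sub>R (s / 2) *\<^sub>R (u + v) + \<alpha> *\<^sub>R (s / 2) *\<^sub>R (u - v) = (s / 2) *\<^sub>R (u + t *\<^sub>R v)"
      and "(s / 2) *\<^sub>R (u + v) + (s / 2) *\<^sub>R (u - v) = s *\<^sub>R u"
      using collect[of \<alpha> "1 - \<alpha>"] collect[of "1 - \<alpha>" \<alpha>] collect[of 1 1] by simp_all
    then have "F ((s / 2) *\<^sub>R (u + v)) ((s / 2) *\<^sub>R (u - v))
        = (norm ((s / 2) *\<^sub>R (u - t *\<^sub>R v)) powr p + norm ((s / 2) *\<^sub>R (u + t *\<^sub>R v)) powr p)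
            / norm (s *\<^sub>R u) powr p"
      unfolding F_def by (simp only:)
    also have "\<dots> = G u v"
      using that by (simp add: G_def powr_mult powr_divide add_divide_distrib)
    finally show ?thesis .
  qed
  have "{F x y | x y. (x, y) \<noteq> (0, 0) \<and> x \<bottom>\<^sub>I y} = {G u v | u v. u \<in> sphere 0 1 \<and> v \<in> sphere 0 1}"
  proof (intro equalityI subsetI; elim CollectE exE conjE)
    fix r and x y :: 'a
    assume r: "r = F x y" and nz: "(x, y) \<noteq> (0, 0)" and o: "x \<bottom>\<^sub>I y"
    define s where "s = norm (x + y)"
    have s: "norm (x - y) = s" using o by (simp add: isosceles_orth_def s_def)
    have "s \<noteq> 0"
    proof
      assume "s = 0"
      then have "x + y = 0" "x = y" using s s_def by auto
      then have "2 *\<^sub>R x = 0" by (simp add: scaleR_2)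
      then show False using \<open>x = y\<close> nz by simp
    qed
    then have "0 < s" by (simp add: s_def)
    define u v where "u = (1 / s) *\<^sub>R (x + y)" and "v = (1 / s) *\<^sub>R (x - y)"
    have h: "z = (1/2) *\<^sub>R z + (1/2) *\<^sub>R z" for z :: 'a
      by (simp flip: scaleR_add_left)
    have "norm u = 1" "norm v = 1"
      using \<open>0 < s\<close> s by (simp_all add: u_def v_def s_def)
    moreover have "x = (s / 2) *\<^sub>R (u + v)" "y = (s / 2) *\<^sub>R (u - v)"
      using \<open>0 < s\<close> h[of x] h[of y] by (simp_all add: u_def v_def algebra_simps)
    ultimately show "r \<in> {G u v | u v. u \<in> sphere 0 1 \<and> v \<in> sphere 0 1}"
      using F_eq_G[of s u v] \<open>0 < s\<close> r by auto
  next
    fix r and u v :: 'a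
    assume r: "r = G u v" and uv: "u \<in> sphere 0 1" "v \<in> sphere 0 1"
    \<comment> \<open>One preimage suffices, so the scale is taken to be 1.\<close>
    define x y where "x = (1 / 2) *\<^sub>R (u + v)" and "y = (1 / 2) *\<^sub>R (u - v)"
    have "x + y = u" "x - y = v"
      by (simp_all add: x_def y_def algebra_simps flip: scaleR_add_left)
    then have "x \<bottom>\<^sub>I y" "(x, y) \<noteq> (0, 0)" using uv by (auto simp: isosceles_orth_def)
    moreover have "r = F x y"
      using F_eq_G[of 1 u v] uv r by (simp add: x_def y_def)
    ultimately show "r \<in> {F x y | x y. (x, y) \<noteq> (0, 0) \<and> x \<bottom>\<^sub>I y}" by blast
  qed
  then show ?thesis by (simp add: C_NJ_I_def F_def G_def t_def)
qed

theorem theorem3: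
  fixes \<alpha> p :: real
  assumes "\<exists>B :: 'a::banach set. independent B \<and> card B = 2"
    and "0 \<le> \<alpha>" "\<alpha> \<le> 1 / 2" and "1 \<le> p"
  shows "1 / 2 powr (p - 1) * (mod_smoothness TYPE('a) (1 - 2 * \<alpha>) + 1) powr p
           \<le> C_NJ_I \<alpha> p TYPE('a)
       \<and> C_NJ_I \<alpha> p TYPE('a) \<le> C_NJ_mod p TYPE('a)"
proof -
  obtain B :: "'a set" where B: "independent B" "card B = 2" using assms(1) by blast
  then obtain b where "b \<in> B" by fastforce
  with B have "b \<noteq> 0" using dependent_zero by blast
  \<comment> \<open>A unit vector makes the sets of values over the sphere nonempty, so that their
    suprema can be bounded by bounding each value.\<close>
  define e where "e = (1 / norm b) *\<^sub>R b"
  have e: "e \<in> sphere 0 1" using \<open>b \<noteq> 0\<close> by (simp add: e_def)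
  define t where "t = 1 - 2 * \<alpha>"
  have t: "0 \<le> t" "t \<le> 1" using assms by (auto simp: t_def)
  \<comment> \<open>One family serves both constants: \<open>s = t\<close> gives
    \<open>C_NJ_I\<close>, \<open>s = 1\<close> gives \<open>C_NJ_mod\<close>.\<close>
  define G where "G s u v = (norm (u + s *\<^sub>R v) powr p + norm (u - s *\<^sub>R v) powr p) / 2 powr p"
    for s and u v :: 'a
  define C where "C = C_NJ_I \<alpha> p TYPE('a)"
  have C: "C = Sup {G t u v | u v. u \<in> sphere 0 1 \<and> v \<in> sphere 0 1}"
    by (simp add: C_def C_NJ_I_eq_Sup_sphere G_def t_def)
  have C_mod: "C_NJ_mod p TYPE('a) = Sup {G 1 u v | u v. u \<in> sphere 0 1 \<and> v \<in> sphere 0 1}"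
    by (simp add: C_NJ_mod_def G_def)
  have G1_bdd: "bdd_above {G 1 u v | u v. u \<in> sphere 0 1 \<and> v \<in> sphere 0 1}"
    using bdd_above_C_NJ_mod[where 'a='a, OF assms(4)] by (simp add: G_def)
  have mono: "G t u v \<le> G 1 u v" for u v
    using norm_powr_add_diff_mono[OF assms(4) t, of u v] by (simp add: G_def divide_right_mono)
  have le_mod: "G t u v \<le> C_NJ_mod p TYPE('a)" if "u \<in> sphere 0 1" "v \<in> sphere 0 1" for u v
    unfolding C_mod using that by (intro order_trans[OF mono] cSup_upper G1_bdd) blast
  then have "bdd_above {G t u v | u v. u \<in> sphere 0 1 \<and> v \<in> sphere 0 1}"
    by (auto intro!: bdd_aboveI[where M = "C_NJ_mod p TYPE('a)"])
  then have le_C: "G t u v \<le> C" if "u \<in> sphere 0 1" "v \<in> sphere 0 1" for u v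
    unfolding C using that by (intro cSup_upper) blast
  have upper: "C \<le> C_NJ_mod p TYPE('a)"
    unfolding C using e le_mod by (intro cSup_least) blast+
  define k where "k = (2::real) powr (p - 1)"
  have "0 < k" by (simp add: k_def)
  \<comment> \<open>Nonnegativity of \<open>C\<close> is what later lets \<open>R powr p\<close>
    return \<open>k * C\<close>.\<close>
  have "0 \<le> G t e e" by (simp add: G_def)
  then have "0 \<le> C" using le_C[OF e e] by simp
  \<comment> \<open>The solution of \<open>1 / k * R powr p = C\<close>. The supremum in
    \<open>mod_smoothness\<close> stands inside the power, so each mean is first bounded by this
    root and the power is taken after passing to the supremum.\<close>
  define R where "R = (k * C) powr (1 / p)"
  have mean_le: "(norm (u + t *\<^sub>R v) + norm (u - t *\<^sub>R v)) / 2 \<le> R"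
    if "u \<in> sphere 0 1" "v \<in> sphere 0 1" for u v :: 'a
  proof -
    let ?m = "(norm (u + t *\<^sub>R v) + norm (u - t *\<^sub>R v)) / 2"
    have "1 / k * ?m powr p \<le> C"
      using powr_mean_le[OF assms(4), of "norm (u + t *\<^sub>R v)" "norm (u - t *\<^sub>R v)"] le_C[OF that]
      by (simp add: G_def k_def)
    then have "?m powr p \<le> k * C" using \<open>0 < k\<close> by (simp add: field_simps)
    then have "(?m powr p) powr (1 / p) \<le> R"
      unfolding R_def using assms(4) by (intro powr_mono2) auto
    then show ?thesis using assms(4) by (simp add: powr_powr)
  qed
  let ?S = "{(norm (x1 + t *\<^sub>R x2) + norm (x1 - t *\<^sub>R x2)) / 2 - 1
         | x1 x2 :: 'a. x1 \<in> sphere 0 1 \<and> x2 \<in> sphere 0 1}"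
  have "Sup ?S \<le> R - 1"
  proof (rule cSup_least)
    show "?S \<noteq> {}" using e by blast
  qed (use mean_le in force)
  \<comment> \<open>Raising to the power \<open>p\<close> is monotone on nonnegative bases, so
    \<open>Sup ?S + 1\<close> must be nonnegative; a single value, at least -1, shows this.\<close>
  moreover have "(norm (e + t *\<^sub>R e) + norm (e - t *\<^sub>R e)) / 2 - 1 \<le> Sup ?S"
    using e by (intro cSup_upper bdd_above_mod_smoothness) blast
  then have "- 1 \<le> Sup ?S"
    using norm_ge_zero[of "e + t *\<^sub>R e"] norm_ge_zero[of "e - t *\<^sub>R e"] by argo
  ultimately have "(mod_smoothness TYPE('a) t + 1) powr p \<le> R powr p"
    unfolding mod_smoothness_def using assms(4) by (intro powr_mono2) auto
  also have "R powr p = k * C"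
    using \<open>0 \<le> C\<close> \<open>0 < k\<close> assms(4) by (simp add: R_def powr_powr)
  finally have "1 / k * (mod_smoothness TYPE('a) t + 1) powr p \<le> C"
    using \<open>0 < k\<close> by (simp add: field_simps)
  with upper show ?thesis by (simp add: C_def k_def t_def)
qed

end
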